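(* Every triple $(x,y,z)$ of positive integers satisfying $(x+y)^2+(y+z)^2+(z+x)^2=12xyz$ appears exactly once, up to order, in the tree $\mathbb{T}$; that is, there is exactly one vertex of $\mathbb{T}$ whose triple is a permutation of $(x,y,z)$.
   Context: $\mathbb{T}$ is the infinite rooted tree whose vertices are triples of positive integers, defined as follows. (1) The root is $(1,1,1)$; its only child is $(1,1,3)$; the only child of $(1,1,3)$ is $(1,13,3)$. (2) From $(1,13,3)$ downward, every vertex $(a,b,c)$ has exactly two children: (i) if $a$ is the maximal number in $(a,b,c)$, the children are $(a,6ac-a-b-c,c)$ and $(a,b,6ab-a-b-c)$; (ii) if $b$ is the maximal number, the children are $(6bc-a-b-c,b,c)$ and $(a,b,6ab-a-b-c)$; (iii) if $c$ is the maximal number, the children are $(6bc-a-b-c,b,c)$ and $(a,6ac-a-b-c,c)$. *)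

theory Defs
  imports Main "HOL-Library.Multiset"
begin

text \<open>
  A vertex of the tree is an address together with the triple it carries.  The address
  lists the child indices chosen on the way from the root, the last choice first, so its
  length is the depth.  With addresses, two positions carrying the same triple would count as
  two vertices.  Triples are integers so that subtraction does not truncate.
\<close>

type_synonym vertex = "nat list \<times> (int \<times> int \<times> int)"

text \<open>
  The triple \<open>(1,13,3)\<close> sits at depth 2, so the premise \<open>length p \<ge> 2\<close> says
  ``from \<open>(1,13,3)\<close> downward''.
\<close>

inductive_set tree_T :: "vertex set" where
  root:  "([], (1, 1, 1)) \<in> tree_T"
| second: "([0], (1, 1, 3)) \<in> tree_T"
| third: "([0, 0], (1, 13, 3)) \<in> tree_T"
| max_a_0: "\<lbrakk>(p, (a, b, c)) \<in> tree_T; length p \<ge> 2; a = Max {a, b, c}\<rbrakk>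
    \<Longrightarrow> (0 # p, (a, 6*a*c - a - b - c, c)) \<in> tree_T"
| max_a_1: "\<lbrakk>(p, (a, b, c)) \<in> tree_T; length p \<ge> 2; a = Max {a, b, c}\<rbrakk>
    \<Longrightarrow> (1 # p, (a, b, 6*a*b - a - b - c)) \<in> tree_T"
| max_b_0: "\<lbrakk>(p, (a, b, c)) \<in> tree_T; length p \<ge> 2; b = Max {a, b, c}\<rbrakk>
    \<Longrightarrow> (0 # p, (6*b*c - a - b - c, b, c)) \<in> tree_T"
| max_b_1: "\<lbrakk>(p, (a, b, c)) \<in> tree_T; length p \<ge> 2; b = Max {a, b, c}\<rbrakk>
    \<Longrightarrow> (1 # p, (a, b, 6*a*b - a - b - c)) \<in> tree_T"
| max_c_0: "\<lbrakk>(p, (a, b, c)) \<in> tree_T; length p \<ge> 2; c = Max {a, b, c}\<rbrakk>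
    \<Longrightarrow> (0 # p, (6*b*c - a - b - c, b, c)) \<in> tree_T"
| max_c_1: "\<lbrakk>(p, (a, b, c)) \<in> tree_T; length p \<ge> 2; c = Max {a, b, c}\<rbrakk>
    \<Longrightarrow> (1 # p, (a, 6*a*c - a - b - c, c)) \<in> tree_T"

definition triple_mset :: "'a \<times> 'a \<times> 'a \<Rightarrow> 'a multiset" where
  "triple_mset = (\<lambda>(a, b, c). {#a, b, c#})"

end

theory Submission
  imports Defs
begin

text \<open>
  The equation is equivalent to \<open>x\<^sup>2 + y\<^sup>2 + z\<^sup>2 + xy + yz + zx = 6xyz\<close>, a monic quadratic in each
  variable, so exchanging the roots (Vieta jumping) maps solutions to solutions.  For a solution
  with maximum \<open>x\<close>, the quadratic in \<open>x\<close> is negative at \<open>max y z\<close> unless \<open>y = z = 1\<close>; hence jumping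
  at the maximum produces a smaller positive solution, and iterating leads to \<open>(1,1,1)\<close> or
  \<open>(1,1,3)\<close>.  Conversely, below \<open>(1,13,3)\<close> a child arises by jumping at a non-maximal entry, and its new
  entry is its strict maximum.  So the parent of a vertex is recovered by jumping at the maximum,
  which makes the vertex carrying a given multiset unique.
\<close>

section \<open>Vieta descent on solutions\<close>

definition solution :: "int \<Rightarrow> int \<Rightarrow> int \<Rightarrow> bool" where
  "solution x y z \<longleftrightarrow> x > 0 \<and> y > 0 \<and> z > 0 \<and>
     x\<^sup>2 + y\<^sup>2 + z\<^sup>2 + x*y + y*z + z*x = 6*x*y*z"

lemma solution_swap: "solution x y z \<longleftrightarrow> solution y x z"
  by (auto simp: solution_def algebra_simps)

lemma solution_rotate: "solution x y z \<longleftrightarrow> solution y z x"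
  by (auto simp: solution_def algebra_simps)

lemma solution_descent:
  assumes "solution x y z" "x \<ge> y" "y \<ge> z" "y \<noteq> 1"
  shows "y < x" "solution (6*y*z - x - y - z) y z" "6*y*z - x - y - z < y"
proof -
  define x' where "x' = 6*y*z - x - y - z"
  have pos: "x > 0" "y > 0" "z > 0"
    and eq: "x\<^sup>2 + y\<^sup>2 + z\<^sup>2 + x*y + y*z + z*x = 6*x*y*z"
    using assms(1) by (auto simp: solution_def)
  \<comment> \<open>\<open>x\<close> and \<open>x'\<close> are the two roots of the quadratic in the
    first variable; this is their product, which forces \<open>x'\<close> to be positive.\<close>
  have prod: "x * x' = y\<^sup>2 + z\<^sup>2 + y*z"
    using eq unfolding x'_def by (simp add: algebra_simps power2_eq_square)
  have "x * x' > 0"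
    unfolding prod using pos by (simp add: add_pos_pos)
  then have x'_pos: "x' > 0"
    using pos by (simp add: zero_less_mult_iff)
  \<comment> \<open>This is the value at \<open>y\<close> of that quadratic; once it is negative,
    \<open>y\<close> lies strictly between the roots.\<close>
  have "(x - y) * (x' - y) = 3*y\<^sup>2 + 2*(y*z) + z\<^sup>2 - 6*y\<^sup>2*z"
    using prod unfolding x'_def by (simp add: algebra_simps power2_eq_square)
  also have "\<dots> < 0"
  proof (cases "z = 1")
    case True
    have "2 * y \<le> y\<^sup>2"
      unfolding power2_eq_square using assms(4) pos by (intro mult_right_mono) auto
    then have "3*y\<^sup>2 + 2*y + 1 - 6*y\<^sup>2 < 0" using assms(4) pos by linarith
    then show ?thesis by (simp add: True)
  next
    case False
    have "y * z \<le> y\<^sup>2" "z * z \<le> y * y"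
      using pos assms(3) by (auto simp: power2_eq_square intro: mult_mono)
    moreover have "y\<^sup>2 * 2 \<le> y\<^sup>2 * z" "0 < y\<^sup>2"
      using False pos by (auto intro: mult_left_mono)
    ultimately show ?thesis by (simp add: power2_eq_square)
  qed
  finally have neg: "(x - y) * (x' - y) < 0" .
  then show "y < x" "6*y*z - x - y - z < y"
    using assms(2) by (auto simp: mult_less_0_iff x'_def)
  have "x'\<^sup>2 + y\<^sup>2 + z\<^sup>2 + x'*y + y*z + z*x' = 6*x'*y*z"
    using eq unfolding x'_def by (simp add: algebra_simps power2_eq_square)
  with x'_pos pos have "solution x' y z" by (simp add: solution_def)
  then show "solution (6*y*z - x - y - z) y z" by (simp add: x'_def)
qed

text \<open>If \<open>z = y\<close>, the descended triple would be a solution whose maximum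
  \<open>y\<close> occurs twice, and a second descent forbids that.\<close>

lemma solution_strict:
  assumes "solution x y z" "x \<ge> y" "y \<ge> z" "y \<noteq> 1"
  shows "z < y"
proof (rule ccontr)
  assume "\<not> z < y"
  then have [simp]: "z = y" using assms by simp
  have "solution y y (6*y*z - x - y - z)" "6*y*z - x - y - z < y"
    using solution_descent[OF assms] solution_rotate by auto
  with solution_descent(1)[of y y "6*y*z - x - y - z"] assms(4) show False by simp
qed

section \<open>Jumps between parent and child in the tree\<close>

lemma jump_gt_max:
  fixes m r s :: int
  assumes "0 < r" "r < m" "s < m"
  shows "m < 6*m*r - m - r - s"
proof -
  have "m * 1 \<le> m * r" using assms by (intro mult_left_mono) auto
  then show ?thesis using assms by linarith
qed

text \<open>From \<open>(1,13,3)\<close> downward the kept entries are distinct by induction and the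
  new one exceeds both. Hence the maximum sits in one position and only one of the clauses (i)-(iii)
  applies.\<close>

lemma tree_T_pos_distinct:
  assumes "(p, (a, b, c)) \<in> tree_T"
  shows "a > 0 \<and> b > 0 \<and> c > 0 \<and> (2 \<le> length p \<longrightarrow> a \<noteq> b \<and> b \<noteq> c \<and> a \<noteq> c)"
  using assms
proof (induction rule: tree_T.induct)
  case (max_a_0 p a b c)
  then show ?case using jump_gt_max[of c a b] by (auto simp: max_def split: if_splits)
next
  case (max_a_1 p a b c)
  then show ?case using jump_gt_max[of b a c] by (auto simp: max_def split: if_splits)
next
  case (max_b_0 p a b c)
  then show ?case using jump_gt_max[of c b a] by (auto simp: max_def split: if_splits)
next
  case (max_b_1 p a b c)
  then show ?case using jump_gt_max[of a b c] by (auto simp: max_def mult_ac split: if_splits)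
next
  case (max_c_0 p a b c)
  then show ?case using jump_gt_max[of b c a] by (auto simp: max_def mult_ac split: if_splits)
next
  case (max_c_1 p a b c)
  then show ?case using jump_gt_max[of a c b] by (auto simp: max_def mult_ac split: if_splits)
qed auto

lemma tree_T_child:
  assumes "(p, t) \<in> tree_T" "2 \<le> length p" "triple_mset t = {#m, r, s#}" "r < m" "s < m"
  obtains k u where "(k # p, u) \<in> tree_T" "triple_mset u = {#6*m*r - m - r - s, m, r#}"
proof -
  obtain a b c where t: "t = (a, b, c)" by (cases t)
  have ms: "{#a, b, c#} = {#m, r, s#}"
    using assms(3) by (simp add: triple_mset_def t)
  \<comment> \<open>The six arrangements of maximum, kept and replaced entry correspond one to one
    to the six rules \<open>max_a_0\<close> to \<open>max_c_1\<close>.\<close>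
  consider "a = m" "b = r" "c = s" | "a = m" "b = s" "c = r" | "a = r" "b = m" "c = s"
    | "a = r" "b = s" "c = m" | "a = s" "b = m" "c = r" | "a = s" "b = r" "c = m"
    using ms by (auto simp: add_eq_conv_ex)
  then show thesis
  proof cases
    case 1
    show ?thesis
      using that tree_T.max_a_1[of p a b c] assms t 1
      by (auto simp: triple_mset_def max_absorb1 max_absorb2 algebra_simps)
  next
    case 2
    show ?thesis
      using that tree_T.max_a_0[of p a b c] assms t 2
      by (auto simp: triple_mset_def max_absorb1 max_absorb2 algebra_simps)
  next
    case 3
    show ?thesis
      using that tree_T.max_b_1[of p a b c] assms t 3
      by (auto simp: triple_mset_def max_absorb1 max_absorb2 algebra_simps)
  next
    case 4
    show ?thesis
      using that tree_T.max_c_1[of p a b c] assms t 4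
      by (auto simp: triple_mset_def max_absorb1 max_absorb2 algebra_simps)
  next
    case 5
    show ?thesis
      using that tree_T.max_b_0[of p a b c] assms t 5
      by (auto simp: triple_mset_def max_absorb1 max_absorb2 algebra_simps)
  next
    case 6
    show ?thesis
      using that tree_T.max_c_0[of p a b c] assms t 6
      by (auto simp: triple_mset_def max_absorb1 max_absorb2 algebra_simps)
  qed
qed

text \<open>
  Only meaningful if the entries are distinct and \<open>s\<close> is a non-maximal one.  Replacing \<open>b\<close> gives
  the first child if \<open>a\<close> is maximal and the second one if \<open>c\<close> is.
\<close>

fun child :: "int \<times> int \<times> int \<Rightarrow> int \<Rightarrow> nat \<times> (int \<times> int \<times> int)" where
  "child (a, b, c) s =
     (if s = a then (0, (6*b*c - a - b - c, b, c))
      else if s = b then (if c < a then 0 else 1, (a, 6*a*c - a - b - c, c))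
      else (1, (a, b, 6*a*b - a - b - c)))"

text \<open>The conclusion \<open>(k, u) = child t s\<close> serves uniqueness: parent and replaced
  value determine the child's index and its ordered triple, which multisets alone would
  lose.\<close>

lemma tree_T_parent:
  assumes "(k # p, u) \<in> tree_T" "2 \<le> length p"
  obtains t m r s where "(p, t) \<in> tree_T" "triple_mset t = {#m, r, s#}"
    "0 < r" "r < m" "s < m" "r \<noteq> s" "(k, u) = child t s"
    "triple_mset u = {#6*m*r - m - r - s, m, r#}"
proof -
  obtain x y z where u: "u = (x, y, z)" by (cases u)
  from assms(1) show thesis unfolding u
  proof cases
    case (max_a_0 b)
    show ?thesis
      using that[of "(x, b, z)" x z b] max_a_0 tree_T_pos_distinct[of p x b z]
      by (auto simp: triple_mset_def max_def algebra_simps u split: if_splits)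
  next
    case (max_a_1 c)
    show ?thesis
      using that[of "(x, y, c)" x y c] max_a_1 tree_T_pos_distinct[of p x y c]
      by (auto simp: triple_mset_def max_def algebra_simps u split: if_splits)
  next
    case (max_b_0 a)
    show ?thesis
      using that[of "(a, y, z)" y z a] max_b_0 tree_T_pos_distinct[of p a y z]
      by (auto simp: triple_mset_def max_def algebra_simps u split: if_splits)
  next
    case (max_b_1 c)
    show ?thesis
      using that[of "(x, y, c)" y x c] max_b_1 tree_T_pos_distinct[of p x y c]
      by (auto simp: triple_mset_def max_def algebra_simps u split: if_splits)
  next
    case (max_c_0 a)
    show ?thesis
      using that[of "(a, y, z)" z y a] max_c_0 tree_T_pos_distinct[of p a y z]
      by (auto simp: triple_mset_def max_def algebra_simps u split: if_splits)
  next
    case (max_c_1 b)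
    show ?thesis
      using that[of "(x, b, z)" z x b] max_c_1 tree_T_pos_distinct[of p x b z]
      by (auto simp: triple_mset_def max_def algebra_simps u split: if_splits)
  qed (use assms(2) in auto)
qed

lemma tree_T_cases:
  assumes "(p, u) \<in> tree_T"
  obtains "p = []" "u = (1, 1, 1)" | "p = [0]" "u = (1, 1, 3)" | "p = [0, 0]" "u = (1, 13, 3)"
    | k q where "p = k # q" "2 \<le> length q"
proof -
  obtain x y z where u: "u = (x, y, z)" by (cases u)
  from assms show thesis unfolding u by cases (use that u in auto)
qed

section \<open>Uniqueness of the vertex\<close>

lemma sorted_mset_eqD:
  fixes x y z :: "'a :: linorder"
  assumes "{#x, y, z#} = {#x', y', z'#}" "x > y" "y > z" "x' > y'" "y' > z'"
  shows "x = x'" "y = y'" "z = z'"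
  using assms by (auto simp: add_eq_conv_ex)

text \<open>By \<open>jump_gt_max\<close> both lists are strictly decreasing, so they agree entry by
  entry; the largest entry then determines \<open>s\<close>.\<close>

lemma jump_unique:
  fixes m r s m' r' s' :: int
  assumes "{#6*m*r - m - r - s, m, r#} = {#6*m'*r' - m' - r' - s', m', r'#}"
    "0 < r" "r < m" "s < m" "0 < r'" "r' < m'" "s' < m'"
  shows "m = m'" "r = r'" "s = s'"
proof -
  have gt: "m < 6*m*r - m - r - s" "m' < 6*m'*r' - m' - r' - s'"
    using assms(2-) jump_gt_max by auto
  from sorted_mset_eqD[OF assms(1) gt(1) assms(3) gt(2) assms(6)]
  have eq: "6*m*r - m - r - s = 6*m'*r' - m' - r' - s'" and "m = m'" "r = r'" by auto
  from this(2,3) show "m = m'" "r = r'" .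
  with eq show "s = s'" by simp
qed

lemma tree_T_jump_not_small:
  assumes "(k # p, u) \<in> tree_T" "2 \<le> length p"
    and "triple_mset u = triple_mset w" "w \<in> {(1, 1, 1), (1, 1, 3), (1, 13, 3)}"
  shows False
  using assms(1,2)
proof (cases rule: tree_T_parent)
  case (1 t m r s)
  have gt: "m < 6*m*r - m - r - s" using 1 jump_gt_max by auto
  \<comment> \<open>The other two triples repeat an entry, whereas a jump yields three distinct
    ones.\<close>
  have "w = (1, 13, 3)"
    using 1 gt assms(3,4) by (auto simp: triple_mset_def add_eq_conv_ex)
  then have ms: "{#6*m*r - m - r - s, m, r#} = {#13, 3, 1#}"
    using 1 assms(3) by (simp add: triple_mset_def add_mset_commute)
  have "m = 3" "r = 1" "6*m*r - m - r - s = 13"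
    using sorted_mset_eqD[OF ms] gt 1 by auto
  \<comment> \<open>\<open>18 - 3 - 1 - s = 13\<close> gives \<open>s = 1 = r\<close>, contrary to
    \<open>r \<noteq> s\<close>.\<close>
  then show False using 1 by auto
qed

lemma tree_T_unique:
  assumes "(p, t) \<in> tree_T" "(q, u) \<in> tree_T" "triple_mset t = triple_mset u"
  shows "p = q \<and> t = u"
  using assms
proof (induction p arbitrary: q t u)
  case Nil
  from Nil(1) have t: "t = (1, 1, 1)" by (cases rule: tree_T_cases) auto
  from Nil(2) show ?case
  proof (cases rule: tree_T_cases)
    case (4 k q')
    then show ?thesis using tree_T_jump_not_small[of k q' u t] Nil t by auto
  qed (use Nil(3) t in \<open>auto simp: triple_mset_def add_eq_conv_ex\<close>)
next
  case (Cons k p)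
  show ?case
  proof (cases "2 \<le> length p")
    case False
    with Cons(2) have t: "k # p = [0] \<and> t = (1, 1, 3) \<or> k # p = [0, 0] \<and> t = (1, 13, 3)"
      by (cases rule: tree_T_cases) auto
    from Cons(3) show ?thesis
    proof (cases rule: tree_T_cases)
      case (4 k q')
      then show ?thesis using tree_T_jump_not_small[of k q' u t] Cons t by auto
    qed (use Cons(4) t in \<open>auto simp: triple_mset_def add_eq_conv_ex\<close>)
  next
    case True
    from Cons(3) obtain l q' where q: "q = l # q'" "2 \<le> length q'"
      by (cases rule: tree_T_cases) (use tree_T_jump_not_small[of k p t u] Cons True in auto)
    obtain t0 m r s where t0: "(p, t0) \<in> tree_T" "triple_mset t0 = {#m, r, s#}"
      "0 < r" "r < m" "s < m" "(k, t) = child t0 s"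
      "triple_mset t = {#6*m*r - m - r - s, m, r#}"
      using tree_T_parent[OF Cons(2) True] by metis
    obtain u0 m' r' s' where u0: "(q', u0) \<in> tree_T" "triple_mset u0 = {#m', r', s'#}"
      "0 < r'" "r' < m'" "s' < m'" "(l, u) = child u0 s'"
      "triple_mset u = {#6*m'*r' - m' - r' - s', m', r'#}"
      using tree_T_parent[of l q' u] Cons(3) q by metis
    \<comment> \<open>The two parents thus carry the same multiset, so they coincide by induction,
      and \<open>child\<close> then returns the same index and triple for both.\<close>
    have "m = m'" "r = r'" "s = s'"
      using jump_unique[of m r s m' r' s'] t0 u0 Cons(4) by auto
    moreover from this have "p = q' \<and> t0 = u0"
      using Cons(1)[OF t0(1) u0(1)] t0 u0 by simp
    ultimately have "(k, t) = (l, u)" using t0 u0 by simp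
    then show ?thesis using q \<open>p = q' \<and> t0 = u0\<close> by simp
  qed
qed

section \<open>Existence of the vertex\<close>

lemma tree_T_exists:
  assumes "solution x y z" "y \<le> x" "z \<le> y"
  shows "\<exists>v \<in> tree_T. triple_mset (snd v) = {#x, y, z#}"
  using assms
proof (induction "nat x" arbitrary: x y z rule: less_induct)
  case less
  have pos: "x > 0" "y > 0" "z > 0" using less(2) by (auto simp: solution_def)
  show ?case
  proof (cases "y = 1")
    case True
    with less pos have z: "z = 1" by simp
    have "(x - 1) * (x - 3) = 0"
      using less(2) True z by (simp add: solution_def algebra_simps power2_eq_square)
    then have "x = 1 \<or> x = 3" by simp
    then show ?thesis
      using tree_T.root tree_T.second True z
      by (force simp: triple_mset_def add_mset_commute)
  next
    case False
    define x' where "x' = 6*y*z - x - y - z"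
    have x': "y < x" "solution x' y z" "x' < y" "z < y"
      using solution_descent[OF less(2-4) False] solution_strict[OF less(2-4) False]
      unfolding x'_def by auto
    \<comment> \<open>The order of \<open>z\<close> and \<open>x'\<close> is unknown, while the
      induction hypothesis wants a sorted triple.\<close>
    have "solution y (max z x') (min z x')"
      using x'(2) solution_rotate solution_swap by (metis max_def min_def)
    moreover have "min z x' \<le> max z x'" by (simp add: min_def max_def)
    ultimately obtain v where "v \<in> tree_T"
      "triple_mset (snd v) = {#y, max z x', min z x'#}"
      using less(1)[of y "max z x'" "min z x'"] x' pos by auto
    then obtain p t where t: "(p, t) \<in> tree_T" "triple_mset t = {#y, z, x'#}"
      by (cases v) (auto simp: max_def min_def add_mset_commute split: if_splits)
    show ?thesis
    proof (cases "2 \<le> length p")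
      case True
      \<comment> \<open>Jumping at \<open>x'\<close> undoes the descent and restores
        \<open>x\<close>.\<close>
      obtain k u where "(k # p, u) \<in> tree_T"
        "triple_mset u = {#6*y*z - y - z - x', y, z#}"
        by (rule tree_T_child[OF t(1) True t(2) x'(4,3)])
      then show ?thesis by (force simp: x'_def)
    next
      case False
      \<comment> \<open>Of the two vertices above \<open>(1,13,3)\<close>, only
        \<open>(1,1,3)\<close> has a strict maximum; jumping back from it gives
        \<open>(1,13,3)\<close> itself.\<close>
      from t(1) have "y = 3 \<and> z = 1 \<and> x' = 1"
        by (cases rule: tree_T_cases)
          (use False t(2) x' in \<open>auto simp: triple_mset_def add_eq_conv_ex\<close>)
      then have "x = 13" "y = 3" "z = 1" by (auto simp: x'_def)
      then show ?thesis
        using tree_T.third by (force simp: triple_mset_def add_mset_commute)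
    qed
  qed
qed

theorem theorem1p1:
  fixes x y z :: int
  assumes "x > 0" and "y > 0" and "z > 0"
    and "(x + y)\<^sup>2 + (y + z)\<^sup>2 + (z + x)\<^sup>2 = 12 * x * y * z"
  shows "\<exists>!v. v \<in> tree_T \<and> triple_mset (snd v) = triple_mset (x, y, z)"
proof -
  have sol: "solution x y z"
    using assms by (simp add: solution_def algebra_simps power2_eq_square)
  obtain a b c where "solution a b c" "b \<le> a" "c \<le> b" "{#a, b, c#} = {#x, y, z#}"
  proof -
    have "solution x z y" "solution y x z" "solution y z x" "solution z x y" "solution z y x"
      using sol solution_rotate solution_swap by blast+
    then show thesis
      using sol that[of x y z] that[of x z y] that[of y x z] that[of y z x] that[of z x y]
        that[of z y x]
      by (smt (verit) add_mset_commute)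
  qed
  then obtain v where v: "v \<in> tree_T" "triple_mset (snd v) = triple_mset (x, y, z)"
    using tree_T_exists[of a b c] by (auto simp: triple_mset_def)
  show ?thesis
  proof (rule ex1I[of _ v])
    show "v \<in> tree_T \<and> triple_mset (snd v) = triple_mset (x, y, z)" using v by simp
    show "w = v" if "w \<in> tree_T \<and> triple_mset (snd w) = triple_mset (x, y, z)" for w
      using that v tree_T_unique[of "fst w" "snd w" "fst v" "snd v"] by (simp add: prod_eq_iff)
  qed
qed

end
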